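(* Consider the primal-dual gradient law $$\dot y = Y\Big[\tfrac{\partial}{\partial y}L(x,y)^T\Big]^+_{\rho},\qquad \dot x=-X\tfrac{\partial}{\partial x}L(x,y)^T. \qquad (\ast)$$ By setting $\zeta_i^\nu=M_i^{-1}$ ($i\in\mathcal G$), $\chi^P_{ij}=B_{ij}$ ($ij\in\mathcal E$) and $\nu_i=\omega_i$ ($i\in\mathcal N$, where for $i\in\mathcal L$ in $(\ast)$ $\nu_i=\nu_i^*(x,y)$), the law $(\ast)$ is equivalent to the power network dynamics $$M_i\dot\omega_i=P_i^{in}-(d_i+D_i\omega_i)-\sum_{e\in\mathcal E}C_{i,e}P_e\quad (i\in\mathcal G),$$ $$0=P_i^{in}-(d_i+D_i\omega_i)-\sum_{e\in\mathcal E}C_{i,e}P_e\quad (i\in\mathcal L),$$ $$\dot P_{ij}=B_{ij}(\omega_i-\omega_j)\quad (ij\in\mathcal E),$$ together with $$\dot\lambda_i=\zeta_i^\lambda\Big(P_i^{in}-d_i-\sum_{j\in\mathcal N_i}B_{ij}(\phi_i-\phi_j)\Big)\quad(i\in\mathcal N),$$ $$\dot\pi_k=\zeta_k^\pi\Big(\sum_{ij\in\mathcal B_k}\hat C_{k,ij}B_{ij}(\phi_i-\phi_j)-\hat P_k\Big)\quad(k\in\mathcal K),$$ $$\dot\rho^+_{ij}=\zeta^{\rho^+}_{ij}\big[B_{ij}(\phi_i-\phi_j)-\overline P_{ij}\big]^+_{\rho^+_{ij}},\qquad \dot\rho^-_{ij}=\zeta^{\rho^-}_{ij}\big[\underline P_{ij}-B_{ij}(\phi_i-\phi_j)\big]^+_{\rho^-_{ij}}\quad(ij\in\mathcal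 E),$$ $$\dot\phi_i=\chi_i^\phi\Big(\sum_{j\in\mathcal N_i}B_{ij}(\lambda_i-\lambda_j)-\sum_{k\in\mathcal K,\,e\in\mathcal B_k}C_{i,e}B_e\hat C_{k,e}\pi_k-\sum_{e\in\mathcal E}C_{i,e}B_e(\rho_e^+-\rho_e^-)\Big)\quad(i\in\mathcal N),$$ $$d_i=(c_i')^{-1}(\lambda_i+\omega_i)\quad(i\in\mathcal N).$$
   Context: Network. $(\mathcal N,\mathcal E)$ is a finite connected directed graph with $ij\in\mathcal E\Rightarrow ji\notin\mathcal E$; $\mathcal N_i$ is the set of neighbors of $i$ (ignoring orientation); $\mathcal N=\mathcal G\cup\mathcal L$ is a partition into generator and load buses. Each line $e=ij$ has susceptance $B_{ij}=B_{ji}>0$; $B=\mathrm{diag}(B_e)_{e\in\mathcal E}$. $C\in\mathbb R^{|\mathcal N|\times|\mathcal E|}$ is the incidence matrix: for $e=ij$, $C_{i,e}=1$, $C_{j,e}=-1$, and other entries are $0$. $L_B=CBC^T$. $D_i>0$ for $i\in\mathcal N$, $M_i>0$ for $i\in\mathcal G$; $P^{in}\in\mathbb R^{|\mathcal N|}$ is given. Areas. $\mathcal K$ is the finite set of control areas, $\mathcal N_k\subseteq\mathcal N$ the buses of area $k$, $\mathcal B_k\subseteq\mathcal E$ the edges with exactly one endpoint in $\mathcal N_k$. $\hat C\in\mathbb R^{|\mathcal K|\times|\mathcal E|}$: for $ij\in\mathcal B_k$, $\hat C_{k,ij}=1$ if $i\in\mathcal N_k$ and $-1$ if $j\in\mathcal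 N_k$; $\hat C_{k,ij}=0$ if $ij\notin\mathcal B_k$. $\hat P\in\mathbb R^{|\mathcal K|}$ and the limits $\overline P,\underline P=-\overline P\in\mathbb R^{|\mathcal E|}$ are given. Costs. $c_i$ is $\alpha$-strongly convex and $C^2$ ($c_i''\ge\alpha>0$) in the interior of $\mathcal D_i=[\underline d_i,\overline d_i]\subseteq\mathbb R$ (possibly unbounded), and $c_i(d_i)\to+\infty$ as $d_i\to\partial\mathcal D_i$. Set $d_i(\cdot):=(c_i')^{-1}(\cdot)$. Reduced Lagrangian. Let $x=(\phi,P)\in\mathbb R^{|\mathcal N|+|\mathcal E|}$, $\sigma=(\lambda,\nu,\pi,\rho^+,\rho^-)$ with $\lambda,\nu\in\mathbb R^{|\mathcal N|}$, $\pi\in\mathbb R^{|\mathcal K|}$, $\rho^\pm\in\mathbb R^{|\mathcal E|}$, $\rho=(\rho^+,\rho^-)$. Let $$\Phi_i(\lambda_i,\nu_i)=c_i(d_i(\lambda_i+\nu_i))-(\lambda_i+\nu_i)d_i(\lambda_i+\nu_i)-\tfrac{D_i}{2}\nu_i^2+(\lambda_i+\nu_i)P_i^{in},$$ $$L(x,\sigma)=\sum_{i\in\mathcal N}\Phi_i(\lambda_i,\nu_i)-P^TC^T\nu-\pi^T\hat P-\rho^{+T}\overline P+\rho^{-T}\underline P-\phi^T\big(L_B\lambda-CB\hat C^T\pi-CB(\rho^+-\rho^-)\big).$$ With $y=(\lambda,\nu_{\mathcal G},\pi,\rho^+,\rho^-)$, define $L(x,y)=\max_{\nu_{\mathcal L}}L(x,\sigma)$,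 with unique maximizer $\nu^*_{\mathcal L}(x,y)$. Gains. $Y$ is the diagonal matrix with positive entries $\zeta^\lambda_i$ ($i\in\mathcal N$), $\zeta^\nu_i$ ($i\in\mathcal G$), $\zeta^\pi_k$, $\zeta^{\rho^+}_e$, $\zeta^{\rho^-}_e$ in the positions of the corresponding components of $y$; $X$ is the diagonal matrix with positive entries $\chi^\phi_i$ ($i\in\mathcal N$) and $\chi^P_e$ ($e\in\mathcal E$) in the positions of the corresponding components of $x$. The projection $[a]^+_\rho$ acts only on the components corresponding to $\rho$: there $[a_i]^+_{\rho_i}=a_i$ if $a_i>0$ or $\rho_i>0$, and $0$ otherwise; other components are unchanged. "Equivalent" means that the two are representations of the same system: under the identification $\nu_{\mathcal G}=\omega_{\mathcal G}$, $\nu^*_{\mathcal L}(x,y)=\omega_{\mathcal L}$, trajectories of $(\ast)$ correspond exactly to trajectories of the second system. *)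

theory Defs
  imports "HOL-Analysis.Analysis" "Graph_Theory.Graph_Theory"
begin

text \<open>
  Vectors over buses, lines and control areas are functions of which only the values on
  \<open>buses\<close>, \<open>lines\<close> and \<open>areas\<close> are meaningful. A line \<open>ij\<close> is the pair \<open>(i, j)\<close>.
\<close>

record ('n, 'k) network =
  grid :: "'n pair_pre_digraph"
  gens :: "'n set"
  loads :: "'n set"
  susc :: "'n \<times> 'n \<Rightarrow> real"
  damp :: "'n \<Rightarrow> real"
  inertia :: "'n \<Rightarrow> real"
  pow_in :: "'n \<Rightarrow> real"
  areas :: "'k set"
  area_buses :: "'k \<Rightarrow> 'n set"
  area_pow :: "'k \<Rightarrow> real"
  flow_max :: "'n \<times> 'n \<Rightarrow> real"
  cost :: "'n \<Rightarrow> real \<Rightarrow> real"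
  load_lo :: "'n \<Rightarrow> ereal"
  load_hi :: "'n \<Rightarrow> ereal"

abbreviation buses :: "('n, 'k) network \<Rightarrow> 'n set" where
  "buses net \<equiv> pverts (grid net)"

abbreviation lines :: "('n, 'k) network \<Rightarrow> ('n \<times> 'n) set" where
  "lines net \<equiv> parcs (grid net)"

abbreviation flow_min :: "('n, 'k) network \<Rightarrow> 'n \<times> 'n \<Rightarrow> real" where
  "flow_min net e \<equiv> - flow_max net e"

definition neighbors :: "('n, 'k) network \<Rightarrow> 'n \<Rightarrow> 'n set" where
  "neighbors net i = {j. (i, j) \<in> lines net \<or> (j, i) \<in> lines net}"

definition boundary :: "('n, 'k) network \<Rightarrow> 'k \<Rightarrow> ('n \<times> 'n) set" where
  "boundary net k = {(i, j) \<in> lines net. (i \<in> area_buses net k) \<noteq> (j \<in> area_buses net k)}"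

definition load_dom :: "('n, 'k) network \<Rightarrow> 'n \<Rightarrow> real set" where
  "load_dom net i = {d. load_lo net i \<le> ereal d \<and> ereal d \<le> load_hi net i}"

definition cost_assumption :: "real \<Rightarrow> (real \<Rightarrow> real) \<Rightarrow> real set \<Rightarrow> bool" where
  "cost_assumption \<alpha> c D \<longleftrightarrow>
     (\<forall>d \<in> interior D. c field_differentiable (at d) \<and>
        deriv c field_differentiable (at d) \<and> deriv (deriv c) d \<ge> \<alpha>) \<and>
     continuous_on (interior D) (deriv (deriv c)) \<and>
     (\<forall>b \<in> frontier D. filterlim c at_top (at b within interior D))"

text \<open>
  The digraph predicate \<open>connected\<close> includes that there is at least one bus.
\<close>

definition power_network :: "('n, 'k) network \<Rightarrow> bool" where
  "power_network net \<longleftrightarrow>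
     pair_fin_digraph (grid net) \<and>
     Digraph_Component.connected (with_proj (grid net)) \<and>
     (\<forall>i j. (i, j) \<in> lines net \<longrightarrow> (j, i) \<notin> lines net) \<and>
     gens net \<union> loads net = buses net \<and> gens net \<inter> loads net = {} \<and>
     (\<forall>(i, j) \<in> lines net. susc net (i, j) = susc net (j, i) \<and> susc net (i, j) > 0) \<and>
     (\<forall>i \<in> buses net. damp net i > 0) \<and>
     (\<forall>i \<in> gens net. inertia net i > 0) \<and>
     finite (areas net) \<and>
     (\<forall>k \<in> areas net. area_buses net k \<subseteq> buses net) \<and>
     (\<forall>i \<in> buses net. load_lo net i < load_hi net i) \<and>
     (\<exists>\<alpha> > 0. \<forall>i \<in> buses net. cost_assumption \<alpha> (cost net i) (load_dom net i))"

definition demand :: "('n, 'k) network \<Rightarrow> 'n \<Rightarrow> real \<Rightarrow> real" where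
  "demand net i = inv_into (interior (load_dom net i)) (deriv (cost net i))"

definition incidence :: "('n, 'k) network \<Rightarrow> 'n \<Rightarrow> 'n \<times> 'n \<Rightarrow> real" where
  "incidence net i e =
     (if e \<in> lines net \<and> i = fst e then 1
      else if e \<in> lines net \<and> i = snd e then - 1
      else 0)"

definition area_incidence :: "('n, 'k) network \<Rightarrow> 'k \<Rightarrow> 'n \<times> 'n \<Rightarrow> real" where
  "area_incidence net k e =
     (if e \<in> boundary net k then if fst e \<in> area_buses net k then 1 else - 1 else 0)"

text \<open>The entries of \<open>L\<^sub>B = C B C\<^sup>T\<close> and \<open>C B A\<^sup>T\<close>, where \<open>C\<close> is \<open>incidence\<close>, \<open>A\<close> is
  \<open>area_incidence\<close> and \<open>B\<close> is the diagonal matrix of \<open>susc\<close>.\<close>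

definition laplacian :: "('n, 'k) network \<Rightarrow> 'n \<Rightarrow> 'n \<Rightarrow> real" where
  "laplacian net i j =
     (\<Sum>e\<in>lines net. incidence net i e * susc net e * incidence net j e)"

definition area_coupling :: "('n, 'k) network \<Rightarrow> 'n \<Rightarrow> 'k \<Rightarrow> real" where
  "area_coupling net i k =
     (\<Sum>e\<in>lines net. incidence net i e * susc net e * area_incidence net k e)"

text \<open>
  The coordinates of \<open>x = (\<phi>, P)\<close> and of \<open>\<sigma> = (\<lambda>, \<nu>, \<pi>, \<rho>\<^sup>+, \<rho>\<^sup>-)\<close>. The vector
  \<open>y = (\<lambda>, \<nu>\<^sub>\<G>, \<pi>, \<rho>\<^sup>+, \<rho>\<^sup>-)\<close> has the same type as \<open>\<sigma>\<close>, but its \<open>\<nu>\<close>-coordinates at load buses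
  are never used.
\<close>

datatype 'n primal_coord = Phi_at 'n | P_at "'n \<times> 'n"

datatype ('n, 'k) dual_coord =
  Lam_at 'n | Nu_at 'n | Pi_at 'k | RhoP_at "'n \<times> 'n" | RhoM_at "'n \<times> 'n"

definition primal_idx :: "('n, 'k) network \<Rightarrow> 'n primal_coord set" where
  "primal_idx net = Phi_at ` buses net \<union> P_at ` lines net"

definition dual_idx :: "('n, 'k) network \<Rightarrow> ('n, 'k) dual_coord set" where
  "dual_idx net = Lam_at ` buses net \<union> Nu_at ` gens net \<union> Pi_at ` areas net
     \<union> RhoP_at ` lines net \<union> RhoM_at ` lines net"

definition bus_dual :: "('n, 'k) network \<Rightarrow> 'n \<Rightarrow> real \<Rightarrow> real \<Rightarrow> real" where
  "bus_dual net i l v =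
     cost net i (demand net i (l + v)) - (l + v) * demand net i (l + v)
     - damp net i / 2 * v\<^sup>2 + (l + v) * pow_in net i"

definition lagrangian ::
  "('n, 'k) network \<Rightarrow> ('n primal_coord \<Rightarrow> real) \<Rightarrow> (('n, 'k) dual_coord \<Rightarrow> real) \<Rightarrow> real" where
  "lagrangian net x \<sigma> =
     (let \<phi> = (\<lambda>i. x (Phi_at i)); P = (\<lambda>e. x (P_at e));
          l = (\<lambda>i. \<sigma> (Lam_at i)); \<nu> = (\<lambda>i. \<sigma> (Nu_at i)); p = (\<lambda>k. \<sigma> (Pi_at k));
          rp = (\<lambda>e. \<sigma> (RhoP_at e)); rm = (\<lambda>e. \<sigma> (RhoM_at e))
      in (\<Sum>i\<in>buses net. bus_dual net i (l i) (\<nu> i))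
         - (\<Sum>e\<in>lines net. P e * (\<Sum>i\<in>buses net. incidence net i e * \<nu> i))
         - (\<Sum>k\<in>areas net. p k * area_pow net k)
         - (\<Sum>e\<in>lines net. rp e * flow_max net e)
         + (\<Sum>e\<in>lines net. rm e * flow_min net e)
         - (\<Sum>i\<in>buses net. \<phi> i *
              ((\<Sum>j\<in>buses net. laplacian net i j * l j)
               - (\<Sum>k\<in>areas net. area_coupling net i k * p k)
               - (\<Sum>e\<in>lines net. incidence net i e * susc net e * (rp e - rm e)))))"

definition with_load_nu ::
  "('n, 'k) network \<Rightarrow> (('n, 'k) dual_coord \<Rightarrow> real) \<Rightarrow> ('n \<Rightarrow> real) \<Rightarrow> ('n, 'k) dual_coord \<Rightarrow> real"
where
  "with_load_nu net y \<nu>L c =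
     (case c of Nu_at i \<Rightarrow> if i \<in> loads net then \<nu>L i else y c | _ \<Rightarrow> y c)"

text \<open>Load vectors are taken extensional, so that the maximizer is unique as a function.\<close>

definition red_lagrangian ::
  "('n, 'k) network \<Rightarrow> ('n primal_coord \<Rightarrow> real) \<Rightarrow> (('n, 'k) dual_coord \<Rightarrow> real) \<Rightarrow> real" where
  "red_lagrangian net x y =
     (GREATEST v. \<exists>\<nu>L \<in> loads net \<rightarrow>\<^sub>E UNIV. v = lagrangian net x (with_load_nu net y \<nu>L))"

definition nu_star ::
  "('n, 'k) network \<Rightarrow> ('n primal_coord \<Rightarrow> real) \<Rightarrow> (('n, 'k) dual_coord \<Rightarrow> real) \<Rightarrow> 'n \<Rightarrow> real" where
  "nu_star net x y =
     (THE \<nu>L. is_arg_max (\<lambda>\<nu>L. lagrangian net x (with_load_nu net y \<nu>L))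
                (\<lambda>\<nu>L. \<nu>L \<in> loads net \<rightarrow>\<^sub>E UNIV) \<nu>L)"

text \<open>
  A solution concept \<open>sol T u f\<close> says that the scalar function \<open>u\<close> solves \<open>u' = f\<close> on the time
  interval \<open>T\<close>. The projected dynamics are discontinuous, so besides differentiable solutions we
  consider Caratheodory solutions: locally absolutely continuous \<open>u\<close> with \<open>u' = f\<close> almost
  everywhere, written in the equivalent integral form.
\<close>

type_synonym sol_concept = "real set \<Rightarrow> (real \<Rightarrow> real) \<Rightarrow> (real \<Rightarrow> real) \<Rightarrow> bool"

definition classical_sol :: sol_concept where
  "classical_sol T u f \<longleftrightarrow> (\<forall>t \<in> T. (u has_real_derivative f t) (at t within T))"

definition caratheodory_sol :: sol_concept where
  "caratheodory_sol T u f \<longleftrightarrow>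
     (\<forall>a \<in> T. \<forall>b \<in> T. a \<le> b \<longrightarrow>
        f absolutely_integrable_on {a..b} \<and> (f has_integral (u b - u a)) {a..b})"

definition pos_proj :: "real \<Rightarrow> real \<Rightarrow> real" where
  "pos_proj r a = (if a > 0 \<or> r > 0 then a else 0)"

definition rho_proj ::
  "(('n, 'k) dual_coord \<Rightarrow> real) \<Rightarrow> (('n, 'k) dual_coord \<Rightarrow> real) \<Rightarrow> ('n, 'k) dual_coord \<Rightarrow> real"
where
  "rho_proj y a c =
     (case c of RhoP_at e \<Rightarrow> pos_proj (y c) (a c) | RhoM_at e \<Rightarrow> pos_proj (y c) (a c) | _ \<Rightarrow> a c)"

definition grad :: "(('i \<Rightarrow> real) \<Rightarrow> real) \<Rightarrow> ('i \<Rightarrow> real) \<Rightarrow> 'i \<Rightarrow> real" where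
  "grad F z c = deriv (\<lambda>s. F (z(c := s))) (z c)"

text \<open>\<open>X\<close> and \<open>Y\<close> list the diagonal entries of the gain matrices.\<close>

definition primal_dual_law ::
  "('n, 'k) network \<Rightarrow> ('n primal_coord \<Rightarrow> real) \<Rightarrow> (('n, 'k) dual_coord \<Rightarrow> real) \<Rightarrow>
   sol_concept \<Rightarrow> real set \<Rightarrow>
   (real \<Rightarrow> 'n primal_coord \<Rightarrow> real) \<Rightarrow> (real \<Rightarrow> ('n, 'k) dual_coord \<Rightarrow> real) \<Rightarrow> bool" where
  "primal_dual_law net X Y sol T x y \<longleftrightarrow>
     (\<forall>c \<in> dual_idx net. sol T (\<lambda>t. y t c)
        (\<lambda>t. Y c * rho_proj (y t) (grad (red_lagrangian net (x t)) (y t)) c)) \<and>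
     (\<forall>c \<in> primal_idx net. sol T (\<lambda>t. x t c)
        (\<lambda>t. - X c * grad (\<lambda>x'. red_lagrangian net x' (y t)) (x t) c))"

definition network_dynamics ::
  "('n, 'k) network \<Rightarrow> ('n primal_coord \<Rightarrow> real) \<Rightarrow> (('n, 'k) dual_coord \<Rightarrow> real) \<Rightarrow>
   sol_concept \<Rightarrow> real set \<Rightarrow>
   (real \<Rightarrow> 'n \<Rightarrow> real) \<Rightarrow> (real \<Rightarrow> 'n \<Rightarrow> real) \<Rightarrow>
   (real \<Rightarrow> 'n \<Rightarrow> real) \<Rightarrow> (real \<Rightarrow> 'n \<times> 'n \<Rightarrow> real) \<Rightarrow>
   (real \<Rightarrow> 'n \<Rightarrow> real) \<Rightarrow> (real \<Rightarrow> 'k \<Rightarrow> real) \<Rightarrow>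
   (real \<Rightarrow> 'n \<times> 'n \<Rightarrow> real) \<Rightarrow> (real \<Rightarrow> 'n \<times> 'n \<Rightarrow> real) \<Rightarrow> bool" where
  "network_dynamics net X Y sol T \<omega> d \<phi> P l p rp rm \<longleftrightarrow>
     (\<forall>i \<in> gens net. sol T (\<lambda>t. inertia net i * \<omega> t i)
        (\<lambda>t. pow_in net i - (d t i + damp net i * \<omega> t i)
               - (\<Sum>e\<in>lines net. incidence net i e * P t e))) \<and>
     (\<forall>i \<in> loads net. \<forall>t \<in> T.
        0 = pow_in net i - (d t i + damp net i * \<omega> t i)
              - (\<Sum>e\<in>lines net. incidence net i e * P t e)) \<and>
     (\<forall>(i, j) \<in> lines net. sol T (\<lambda>t. P t (i, j))
        (\<lambda>t. susc net (i, j) * (\<omega> t i - \<omega> t j))) \<and>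
     (\<forall>i \<in> buses net. sol T (\<lambda>t. l t i)
        (\<lambda>t. Y (Lam_at i) * (pow_in net i - d t i
               - (\<Sum>j\<in>neighbors net i. susc net (i, j) * (\<phi> t i - \<phi> t j))))) \<and>
     (\<forall>k \<in> areas net. sol T (\<lambda>t. p t k)
        (\<lambda>t. Y (Pi_at k) *
          ((\<Sum>(i, j)\<in>boundary net k.
              area_incidence net k (i, j) * susc net (i, j) * (\<phi> t i - \<phi> t j))
           - area_pow net k))) \<and>
     (\<forall>(i, j) \<in> lines net. sol T (\<lambda>t. rp t (i, j))
        (\<lambda>t. Y (RhoP_at (i, j)) * pos_proj (rp t (i, j))
               (susc net (i, j) * (\<phi> t i - \<phi> t j) - flow_max net (i, j)))) \<and>
     (\<forall>(i, j) \<in> lines net. sol T (\<lambda>t. rm t (i, j))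
        (\<lambda>t. Y (RhoM_at (i, j)) * pos_proj (rm t (i, j))
               (flow_min net (i, j) - susc net (i, j) * (\<phi> t i - \<phi> t j)))) \<and>
     (\<forall>i \<in> buses net. sol T (\<lambda>t. \<phi> t i)
        (\<lambda>t. X (Phi_at i) *
          ((\<Sum>j\<in>neighbors net i. susc net (i, j) * (l t i - l t j))
           - (\<Sum>k\<in>areas net. \<Sum>e\<in>boundary net k.
                incidence net i e * susc net e * area_incidence net k e * p t k)
           - (\<Sum>e\<in>lines net. incidence net i e * susc net e * (rp t e - rm t e))))) \<and>
     (\<forall>i \<in> buses net. \<forall>t \<in> T. d t i = demand net i (l t i + \<omega> t i))"

end

theory Submission
  imports Defs
begin

text \<open>
  The claim is that the right-hand sides of the two systems agree coordinate by coordinate, so its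
  core is the computation of the gradient of the reduced Lagrangian, whose load frequencies have been
  maximized out.

  The Lagrangian couples the buses only through terms that are bilinear in \<open>x\<close> and \<open>\<sigma>\<close>. As a
  function of the load frequencies it is therefore a constant plus one strictly concave function
  \<open>\<Phi>\<^sub>i(\<lambda>\<^sub>i, \<nu>\<^sub>i) - q\<^sub>i \<nu>\<^sub>i\<close> per load bus, where \<open>q\<^sub>i\<close> is the power that flows out of bus \<open>i\<close>, and
  the maximization splits into scalar ones. The first-order condition of the scalar problem is the
  power balance at the load bus. This is why the algebraic equation of the network dynamics says
  precisely that \<open>\<omega>\<^sub>i\<close> is the maximizer \<open>\<nu>\<^sub>i\<^sup>*(x, y)\<close> (\<open>load_balance_iff\<close>, \<open>nu_star_eq\<close>).

  Differentiating the maximal value calls for an envelope theorem, which two Legendre transforms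
  provide. With \<open>c\<^sub>i\<^sup>*(s) = s d\<^sub>i(s) - c\<^sub>i(d\<^sub>i(s))\<close>, the conjugate of the cost, one has
  \[ \Phi_i(\lambda,\nu) = -c_i^*(\lambda+\nu) - \tfrac{D_i}{2}\nu^2 + (\lambda+\nu)P^{in}_i . \]
  Put \<open>u = \<lambda> + \<nu>\<close> and \<open>F(u) = c\<^sub>i\<^sup>*(u) + D\<^sub>i u\<^sup>2 / 2\<close>. Completing the square gives
  \[ \max_\nu\,(\Phi_i(\lambda,\nu) - q\nu)
       = F^*(P^{in}_i - q + D_i\lambda) - \tfrac{D_i}{2}\lambda^2 + \lambda q . \]
  Both \<open>c\<^sub>i\<close> and \<open>F\<close> are strongly convex and their slopes take every real value, for \<open>c\<^sub>i\<close> because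
  the cost blows up at the finite ends of its domain. For such a function the conjugate is
  differentiable and its derivative is the inverse of the slope; the locale
  \<open>coercive_strongly_convex\<close> proves this once for both uses (\<open>conjugate_deriv\<close>). Hence the
  reduced Lagrangian is differentiable along every differentiable curve, the maximizers entering as
  if they were constants (\<open>red_lagrangian_deriv\<close>), and the unit directions yield its partial
  derivatives. Matching them with the network equations takes the identities between sums over lines,
  sums over neighbors and the matrices \<open>L\<^sub>B\<close> and \<open>CB\<close>, the choice of the two gains, and the fact
  that a solution concept on \<open>T\<close> sees only values on \<open>T\<close> and respects scaling
  (\<open>sol_cong\<close>, \<open>sol_scale\<close>).
\<close>

section \<open>Conjugates of strongly convex functions on an interval\<close>

text \<open>
  The derivatives \<open>f'\<close> and \<open>f''\<close> are parameters, so that instances can supply closed formulas for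
  them. The blow-up condition concerns only the finite ends of \<open>I\<close>. At an infinite end, strong
  convexity alone makes the slope unbounded.
\<close>
locale coercive_strongly_convex =
  fixes I :: "real set" and f f' f'' :: "real \<Rightarrow> real" and a :: real
  assumes open_dom: "open I" and interval_dom: "is_interval I" and dom_nonempty: "I \<noteq> {}"
    and modulus_pos: "a > 0"
    and deriv1: "x \<in> I \<Longrightarrow> (f has_real_derivative f' x) (at x)"
    and deriv2: "x \<in> I \<Longrightarrow> (f' has_real_derivative f'' x) (at x)"
    and modulus_le: "x \<in> I \<Longrightarrow> a \<le> f'' x"
    and blow_up: "b \<in> frontier I \<Longrightarrow> filterlim f at_top (at b within I)"
begin

lemma between_in_dom: "x \<in> I \<Longrightarrow> y \<in> I \<Longrightarrow> x \<le> z \<Longrightarrow> z \<le> y \<Longrightarrow> z \<in> I"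
  using interval_dom unfolding is_interval_1 by blast

lemma slope_growth:
  assumes "x \<in> I" "y \<in> I" "x \<le> y"
  shows "a * (y - x) \<le> f' y - f' x"
proof (cases "x = y")
  case False
  then obtain z where z: "x < z" "z < y" "f' y - f' x = (y - x) * f'' z"
    using MVT2[of x y f' f''] assms deriv2 between_in_dom by (metis order_le_less)
  have "a \<le> f'' z" using z assms between_in_dom modulus_le by (meson less_imp_le)
  then show ?thesis using z assms by (simp add: mult.commute mult_left_mono)
qed simp

lemma slope_strict_mono:
  assumes "x \<in> I" "y \<in> I" "x < y" shows "f' x < f' y"
proof -
  have "0 < a * (y - x)" using assms modulus_pos by simp
  then show ?thesis using slope_growth[of x y] assms by linarith
qed

lemma above_tangent:
  assumes "x \<in> I" "y \<in> I" "x \<noteq> y"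
  shows "f x + f' x * (y - x) < f y"
proof (cases "x < y")
  case True
  then obtain z where z: "x < z" "z < y" "f y - f x = (y - x) * f' z"
    using MVT2[of x y f f'] assms deriv1 between_in_dom by metis
  have "f' x < f' z" using z assms between_in_dom slope_strict_mono by (meson less_imp_le)
  then have "(y - x) * f' x < f y - f x" using True unfolding z(3) by simp
  then show ?thesis by (simp add: mult.commute)
next
  case False
  then have "y < x" using assms by simp
  then obtain z where z: "y < z" "z < x" "f x - f y = (x - y) * f' z"
    using MVT2[of y x f f'] assms deriv1 between_in_dom by metis
  have "f' z < f' x" using z assms between_in_dom slope_strict_mono by (meson less_imp_le)
  then have "f x - f y < (x - y) * f' x" using \<open>y < x\<close> unfolding z(3) by simp
  then show ?thesis by (simp add: algebra_simps)
qed

text \<open>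
  If the slope were bounded above, \<open>f\<close> would stay bounded on approaching a finite right end of the
  interval, against the blow-up condition. If the interval is unbounded to the right, the slope grows
  at least linearly.
\<close>
lemma slope_unbounded_above: "\<exists>x\<in>I. s < f' x"
proof (rule ccontr)
  assume "\<not> ?thesis"
  then have le: "f' x \<le> s" if "x \<in> I" for x using that by force
  obtain x0 where x0: "x0 \<in> I" using dom_nonempty by blast
  show False
  proof (cases "bdd_above I")
    case True
    define b where "b = Sup I"
    have upper: "x \<le> b" if "x \<in> I" for x
      unfolding b_def using that True by (rule cSup_upper)
    have notin: "b \<notin> I"
    proof
      assume "b \<in> I"
      then obtain e where "e > 0" "ball b e \<subseteq> I" using open_dom openE by blast
      then have "b + e / 2 \<in> I" by (auto simp: dist_real_def subset_iff)
      then show False using upper[of "b + e / 2"] \<open>e > 0\<close> by simp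
    qed
    have clos: "b \<in> closure I" unfolding b_def using dom_nonempty True by (rule closure_contains_Sup)
    have front: "b \<in> frontier I"
      using clos notin open_dom by (simp add: frontier_def interior_open)
    have nontriv: "at b within I \<noteq> bot"
      using clos notin by (simp add: closure_def trivial_limit_within)
    have "x0 < b" using upper[OF x0] notin x0 by (metis order_le_less)
    \<comment> \<open>A slope of at most \<open>s\<close> bounds \<open>f\<close> to the right of \<open>x0\<close> by this constant.\<close>
    define K where "K = f x0 + \<bar>s\<bar> * (b - x0)"
    have "\<forall>\<^sub>F x in at b within I. K < f x"
      using blow_up[OF front] by (simp add: filterlim_at_top_dense)
    moreover have "\<forall>\<^sub>F x in at b within I. x0 < x"
      using tendsto_ident_at \<open>x0 < b\<close> by (rule order_tendstoD)
    moreover have "\<forall>\<^sub>F x in at b within I. x \<in> I" by (simp add: eventually_at_filter)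
    ultimately have "\<forall>\<^sub>F x in at b within I. K < f x \<and> x0 < x \<and> x \<in> I"
      by (intro eventually_conj)
    then obtain x where x: "K < f x" "x0 < x" "x \<in> I"
      using nontriv eventually_happens' by (metis (no_types, lifting))
    obtain z where z: "x0 < z" "z < x" "f x - f x0 = (x - x0) * f' z"
      using MVT2[of x0 x f f'] x x0 deriv1 between_in_dom by metis
    have "f' z \<le> \<bar>s\<bar>" using le[of z] between_in_dom[of x0 x z] x x0 z by simp
    then have "(x - x0) * f' z \<le> (b - x0) * \<bar>s\<bar>"
      using x upper[of x] by (intro order_trans[OF mult_left_mono mult_right_mono]) auto
    then show False using z x by (simp add: K_def mult.commute)
  next
    case False
    then obtain y where y: "y \<in> I" "max x0 (x0 + (s - f' x0 + 1) / a) < y"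
      unfolding bdd_above_def by (meson not_le)
    then have "s - f' x0 + 1 < a * (y - x0)"
      using modulus_pos by (simp add: field_simps)
    then show False using slope_growth[of x0 y] le[of y] x0 y by simp
  qed
qed

text \<open>
  The preceding lemma for the reflected function \<open>x \<mapsto> f (- x)\<close>.
\<close>
lemma slope_unbounded_below: "\<exists>x\<in>I. f' x < s"
proof -
  interpret refl: coercive_strongly_convex "uminus ` I" "\<lambda>x. f (- x)" "\<lambda>x. - f' (- x)"
    "\<lambda>x. f'' (- x)" a
  proof
    show "open (uminus ` I)" by (simp add: open_dom open_negations)
    show "is_interval (uminus ` I)" using interval_dom by simp
    show "uminus ` I \<noteq> {}" using dom_nonempty by simp
    show "a > 0" by (fact modulus_pos)
    fix x assume "x \<in> uminus ` I"
    then have x: "- x \<in> I" by auto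
    show "((\<lambda>x. f (- x)) has_real_derivative - f' (- x)) (at x)"
      using deriv1[OF x] unfolding DERIV_mirror .
    show "((\<lambda>x. - f' (- x)) has_real_derivative f'' (- x)) (at x)"
      using deriv2[OF x, unfolded DERIV_mirror, THEN DERIV_minus] by simp
    show "a \<le> f'' (- x)" using x by (rule modulus_le)
  next
    fix b assume "b \<in> frontier (uminus ` I)"
    moreover have "frontier (uminus ` I) = uminus ` frontier I"
      using closure_injective_linear_image[of uminus I]
      by (simp add: frontier_def interior_negations image_set_diff linear_iff)
    ultimately have b: "- b \<in> frontier I" by auto
    have "filterlim uminus (at (- b) within I) (at b within uminus ` I)"
      unfolding filterlim_at by (auto simp: eventually_at_filter intro!: tendsto_eq_intros always_eventually)
    then show "filterlim (\<lambda>x. f (- x)) at_top (at b within uminus ` I)"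
      by (rule filterlim_compose[OF blow_up[OF b]])
  qed
  show ?thesis using refl.slope_unbounded_above[of "- s"] by auto
qed

lemma slope_surj: "\<exists>x\<in>I. f' x = s"
proof -
  obtain x y where xy: "x \<in> I" "f' x < s" "y \<in> I" "s < f' y"
    using slope_unbounded_above slope_unbounded_below by blast
  have "continuous_on I f'"
    using deriv2 DERIV_isCont by (blast intro: continuous_at_imp_continuous_on)
  then have "is_interval (f' ` I)"
    using interval_dom by (simp add: is_interval_connected_1 connected_continuous_image)
  then have "s \<in> f' ` I" using xy by (force simp: is_interval_1)
  then show ?thesis by blast
qed

definition slope_inv :: "real \<Rightarrow> real" where
  "slope_inv = inv_into I f'"

definition conjugate :: "real \<Rightarrow> real" where
  "conjugate s = s * slope_inv s - f (slope_inv s)"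

lemma slope_inv_in_dom [simp]: "slope_inv s \<in> I"
  and slope_slope_inv [simp]: "f' (slope_inv s) = s"
  using slope_surj[of s] unfolding slope_inv_def by (auto intro: inv_into_into f_inv_into_f)

lemma slope_inv_eqI: "x \<in> I \<Longrightarrow> f' x = s \<Longrightarrow> slope_inv s = x"
  by (metis less_irrefl linorder_neqE slope_inv_in_dom slope_slope_inv slope_strict_mono)

lemma slope_inv_lipschitz: "\<bar>slope_inv s - slope_inv t\<bar> \<le> \<bar>s - t\<bar> / a"
proof -
  have *: "a * \<bar>slope_inv s - slope_inv t\<bar> \<le> \<bar>s - t\<bar>"
  proof (cases "slope_inv s \<le> slope_inv t")
    case True
    then show ?thesis using slope_growth[of "slope_inv s" "slope_inv t"] by simp
  next
    case False
    then show ?thesis using slope_growth[of "slope_inv t" "slope_inv s"] by simp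
  qed
  then show ?thesis using modulus_pos by (simp add: field_simps)
qed

lemma isCont_slope_inv: "isCont slope_inv s"
proof -
  have "((\<lambda>t. slope_inv t - slope_inv s) \<longlongrightarrow> 0) (at s)"
  proof (rule Lim_null_comparison)
    show "\<forall>\<^sub>F t in at s. norm (slope_inv t - slope_inv s) \<le> \<bar>t - s\<bar> / a"
      using slope_inv_lipschitz by simp
    show "((\<lambda>t. \<bar>t - s\<bar> / a) \<longlongrightarrow> 0) (at s)"
      using modulus_pos by (auto intro!: tendsto_eq_intros)
  qed
  then show ?thesis by (simp add: isCont_def LIM_zero_iff)
qed

lemma slope_inv_deriv: "(slope_inv has_real_derivative inverse (f'' (slope_inv s))) (at s)"
proof (rule DERIV_inverse_function[where f = f' and a = "s - 1" and b = "s + 1"])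
  show "f'' (slope_inv s) \<noteq> 0"
    using modulus_le[of "slope_inv s"] modulus_pos by simp
qed (auto simp: deriv2 isCont_slope_inv)

text \<open>
  In \<open>s g(s) - f(g(s))\<close> with \<open>g\<close> the inverse slope, the terms containing \<open>g'(s)\<close> cancel because
  \<open>f'(g(s)) = s\<close>. This cancellation is all that is left of the envelope theorem.
\<close>
lemma conjugate_deriv: "(conjugate has_real_derivative slope_inv s) (at s)"
proof -
  have "((\<lambda>s. s * slope_inv s - f (slope_inv s)) has_real_derivative slope_inv s) (at s)"
    by (rule derivative_eq_intros DERIV_chain2[OF deriv1] slope_inv_deriv refl slope_inv_in_dom)+ simp
  then show ?thesis by (simp add: conjugate_def[abs_def])
qed

text \<open>
  The graph of \<open>f\<close> lies strictly above its tangent at the point of slope \<open>s\<close>, so that point is the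
  only one where the supremum defining the convex conjugate is attained.
\<close>
lemma conjugate_strict_max:
  assumes "x \<in> I" "x \<noteq> slope_inv s"
  shows "s * x - f x < conjugate s"
  using above_tangent[of "slope_inv s" x] assms by (simp add: conjugate_def algebra_simps)

end

section \<open>Solution concepts\<close>

text \<open>
  The Caratheodory condition evaluates its data on \<open>{a..b}\<close> for end points in \<open>T\<close>; this stays
  inside \<open>T\<close> because \<open>T\<close> is an interval.
\<close>
lemma sol_cong:
  assumes "is_interval T" "sol \<in> {classical_sol, caratheodory_sol}"
    and "\<And>t. t \<in> T \<Longrightarrow> u t = v t" "\<And>t. t \<in> T \<Longrightarrow> f t = g t"
  shows "sol T u f \<longleftrightarrow> sol T v g"
proof -
  have imp: "sol T u f \<Longrightarrow> sol T v g"
    if eq: "\<And>t. t \<in> T \<Longrightarrow> u t = v t" "\<And>t. t \<in> T \<Longrightarrow> f t = g t" for u v f g :: "real \<Rightarrow> real"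
  proof -
    assume s: "sol T u f"
    show "sol T v g"
    proof (cases "sol = classical_sol")
      case True
      show ?thesis unfolding True classical_sol_def
      proof
        fix t assume t: "t \<in> T"
        then have "(u has_real_derivative g t) (at t within T)"
          using s eq(2)[of t] unfolding True classical_sol_def by metis
        then show "(v has_real_derivative g t) (at t within T)"
          using has_field_derivative_transform_within[OF _ zero_less_one t] eq(1) by blast
      qed
    next
      case False
      then have car: "sol = caratheodory_sol" using assms(2) by simp
      show ?thesis unfolding car caratheodory_sol_def
      proof (intro ballI impI)
        fix a b assume ab: "a \<in> T" "b \<in> T" "a \<le> b"
        have sub: "g t = f t" if "t \<in> {a..b}" for t
          using that ab assms(1) eq(2) by (metis atLeastAtMost_iff is_interval_1)
        have "f absolutely_integrable_on {a..b} \<and> (f has_integral (u b - u a)) {a..b}"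
          using s ab unfolding car caratheodory_sol_def by blast
        then show "g absolutely_integrable_on {a..b} \<and> (g has_integral (v b - v a)) {a..b}"
          using sub eq(1)[of a] eq(1)[of b] ab has_integral_cong[of "{a..b}" g f]
            absolutely_integrable_spike_eq[of "{}" "{a..b}" g f] by auto
      qed
    qed
  qed
  show ?thesis using imp[of u v f g] imp[of v u g f] assms(3,4) by metis
qed

lemma sol_scale:
  assumes "sol \<in> {classical_sol, caratheodory_sol}" "m \<noteq> 0"
  shows "sol T (\<lambda>t. m * u t) f \<longleftrightarrow> sol T u (\<lambda>t. inverse m * f t)"
proof -
  have imp: "sol T (\<lambda>t. k * u t) (\<lambda>t. k * f t)" if "sol T u f" for k and u f :: "real \<Rightarrow> real"
  proof (cases "sol = classical_sol")
    case True
    then show ?thesis using that unfolding True classical_sol_def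
      by (auto intro: DERIV_cmult)
  next
    case False
    then have car: "sol = caratheodory_sol" using assms(1) by simp
    show ?thesis using that unfolding car caratheodory_sol_def
      by (auto simp: right_diff_distrib[symmetric] has_integral_mult_right)
  qed
  show ?thesis
    using imp[of "\<lambda>t. m * u t" f "inverse m"] imp[of u "\<lambda>t. inverse m * f t" m] assms(2)
    by (auto simp: mult.assoc[symmetric])
qed

section \<open>Bus-wise structure of the Lagrangian\<close>

lemma is_arg_max_separable:
  fixes \<theta> :: "'i \<Rightarrow> real \<Rightarrow> real"
  assumes "finite S" and max: "\<And>i v. i \<in> S \<Longrightarrow> v \<noteq> m i \<Longrightarrow> \<theta> i v < \<theta> i (m i)"
  shows "is_arg_max (\<lambda>w. K + (\<Sum>i\<in>S. \<theta> i (w i))) (\<lambda>w. w \<in> S \<rightarrow>\<^sub>E UNIV) w \<longleftrightarrow> w = restrict m S"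
proof -
  have le: "(\<Sum>i\<in>S. \<theta> i (w i)) \<le> (\<Sum>i\<in>S. \<theta> i (restrict m S i))" for w
    using max by (intro sum_mono) (metis less_imp_le order_refl restrict_apply')
  have less: "(\<Sum>i\<in>S. \<theta> i (w i)) < (\<Sum>i\<in>S. \<theta> i (restrict m S i))"
    if w: "w \<in> S \<rightarrow>\<^sub>E UNIV" "w \<noteq> restrict m S" for w
  proof -
    obtain i where "i \<in> S" "w i \<noteq> m i"
      using w by (metis PiE_restrict restrict_ext)
    then show ?thesis using max \<open>finite S\<close>
      by (intro sum_strict_mono_ex1) (auto, metis less_imp_le order_refl)
  qed
  have "restrict m S \<in> S \<rightarrow>\<^sub>E UNIV" by auto
  then show ?thesis
    using le less unfolding is_arg_max_linorder by (metis add_le_cancel_left not_less)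
qed

definition drop_along :: "('n \<Rightarrow> real) \<Rightarrow> 'n \<times> 'n \<Rightarrow> real" where
  "drop_along z e = z (fst e) - z (snd e)"

definition outflow :: "('n, 'k) network \<Rightarrow> ('n primal_coord \<Rightarrow> real) \<Rightarrow> 'n \<Rightarrow> real" where
  "outflow net x i = (\<Sum>e\<in>lines net. incidence net i e * x (P_at e))"

text \<open>
  The Lagrangian contains \<open>\<phi>\<close> only through the line flows \<open>B\<^sub>e (\<phi>\<^sub>i - \<phi>\<^sub>j)\<close>; \<open>line_gap\<close> is the
  negative of the coefficient of the flow on \<open>e\<close>, and \<open>line_terms\<close> is what remains of the Lagrangian
  once the bus terms \<open>\<Phi>\<^sub>i(\<lambda>\<^sub>i, \<nu>\<^sub>i) - q\<^sub>i \<nu>\<^sub>i\<close> are taken out.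
\<close>
definition line_gap :: "('n, 'k) network \<Rightarrow> (('n, 'k) dual_coord \<Rightarrow> real) \<Rightarrow> 'n \<times> 'n \<Rightarrow> real" where
  "line_gap net y e = drop_along (\<lambda>i. y (Lam_at i)) e
     - (\<Sum>k\<in>areas net. area_incidence net k e * y (Pi_at k)) - (y (RhoP_at e) - y (RhoM_at e))"

definition line_terms ::
  "('n, 'k) network \<Rightarrow> ('n primal_coord \<Rightarrow> real) \<Rightarrow> (('n, 'k) dual_coord \<Rightarrow> real) \<Rightarrow> real" where
  "line_terms net x y =
     - (\<Sum>k\<in>areas net. y (Pi_at k) * area_pow net k)
     - (\<Sum>e\<in>lines net. y (RhoP_at e) * flow_max net e)
     + (\<Sum>e\<in>lines net. y (RhoM_at e) * flow_min net e)
     - (\<Sum>e\<in>lines net. susc net e * drop_along (\<lambda>i. x (Phi_at i)) e * line_gap net y e)"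

text \<open>
  At fixed \<open>\<lambda>\<^sub>i\<close> and outflow \<open>q\<^sub>i\<close>, the power balance \<open>d\<^sub>i(\<lambda>\<^sub>i + \<nu>\<^sub>i) + D\<^sub>i \<nu>\<^sub>i = P\<^sub>i\<^sup>i\<^sup>n - q\<^sub>i\<close> becomes an
  equation for \<open>u = \<lambda>\<^sub>i + \<nu>\<^sub>i\<close> alone after adding \<open>D\<^sub>i \<lambda>\<^sub>i\<close> on both sides. Its solution is the load
  response.
\<close>
definition load_response :: "('n, 'k) network \<Rightarrow> 'n \<Rightarrow> real \<Rightarrow> real" where
  "load_response net i = inv_into UNIV (\<lambda>u. demand net i u + damp net i * u)"

definition load_nu :: "('n, 'k) network \<Rightarrow> 'n \<Rightarrow> real \<Rightarrow> real \<Rightarrow> real" where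
  "load_nu net i l q = load_response net i (pow_in net i - q + damp net i * l) - l"

definition load_value :: "('n, 'k) network \<Rightarrow> 'n \<Rightarrow> real \<Rightarrow> real \<Rightarrow> real" where
  "load_value net i l q = bus_dual net i l (load_nu net i l q) - q * load_nu net i l q"

definition bus_nu ::
  "('n, 'k) network \<Rightarrow> ('n primal_coord \<Rightarrow> real) \<Rightarrow> (('n, 'k) dual_coord \<Rightarrow> real) \<Rightarrow> 'n \<Rightarrow> real" where
  "bus_nu net x y i =
     (if i \<in> gens net then y (Nu_at i) else load_nu net i (y (Lam_at i)) (outflow net x i))"

locale power_system =
  fixes net :: "('n, 'k) network"
  assumes power_network: "power_network net"
begin

lemma finite_buses [simp]: "finite (buses net)"
  and finite_lines [simp]: "finite (lines net)"
  and finite_areas [simp]: "finite (areas net)"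
  using power_network pair_fin_digraph.pair_finite_verts pair_fin_digraph.pair_finite_arcs
  unfolding power_network_def by blast+

lemma line_ends: "e \<in> lines net \<Longrightarrow> fst e \<in> buses net" "e \<in> lines net \<Longrightarrow> snd e \<in> buses net"
proof -
  have "pair_wf_digraph (grid net)"
    using power_network pair_fin_digraph.axioms(1) unfolding power_network_def by blast
  then show "e \<in> lines net \<Longrightarrow> fst e \<in> buses net" "e \<in> lines net \<Longrightarrow> snd e \<in> buses net"
    by (auto intro: pair_wf_digraph.arc_fst_in_verts pair_wf_digraph.arc_snd_in_verts)
qed

lemma line_asym: "(i, j) \<in> lines net \<Longrightarrow> (j, i) \<notin> lines net"
  using power_network unfolding power_network_def by blast

lemma line_no_loop: "e \<in> lines net \<Longrightarrow> fst e \<noteq> snd e"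
  using line_asym by (metis prod.collapse)

lemma susc_sym: "(i, j) \<in> lines net \<Longrightarrow> susc net (i, j) = susc net (j, i)"
  using power_network unfolding power_network_def by blast

lemma buses_split: "buses net = gens net \<union> loads net" "gens net \<inter> loads net = {}"
  using power_network unfolding power_network_def by blast+

lemma finite_gens [simp]: "finite (gens net)" and finite_loads [simp]: "finite (loads net)"
  using finite_buses unfolding buses_split(1) by simp_all

lemma gens_not_load: "i \<in> gens net \<Longrightarrow> i \<notin> loads net"
  using buses_split(2) by blast

lemma sum_buses: "(\<Sum>i\<in>buses net. h i) = (\<Sum>i\<in>gens net. h i) + (\<Sum>i\<in>loads net. h i :: real)"
  unfolding buses_split(1) by (rule sum.union_disjoint) (simp_all add: buses_split(2))

lemma damp_pos: "i \<in> buses net \<Longrightarrow> 0 < damp net i"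
  using power_network unfolding power_network_def by blast

lemma inertia_pos: "i \<in> gens net \<Longrightarrow> 0 < inertia net i"
  using power_network unfolding power_network_def by blast

lemma incidence_line:
  "e \<in> lines net \<Longrightarrow>
     incidence net i e = (if i = fst e then 1 else 0) - (if i = snd e then 1 else 0)"
  using line_no_loop[of e] by (auto simp: incidence_def)

lemma incidence_transpose:
  assumes "e \<in> lines net"
  shows "(\<Sum>i\<in>buses net. z i * incidence net i e) = drop_along z e"
  using line_ends[OF assms]
  by (simp add: incidence_line[OF assms] right_diff_distrib sum_subtractf drop_along_def
        mult_delta_right)

lemma drop_along_unit:
  "e \<in> lines net \<Longrightarrow> drop_along (\<lambda>j. if j = i then 1 else 0) e = incidence net i e"
  by (auto simp: incidence_line drop_along_def)

text \<open>
  Each line at bus \<open>i\<close> joins it to exactly one neighbor. Reversing a line flips both its incidence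
  sign and its drop, so the orientation disappears from the sum.
\<close>
lemma neighbor_sum:
  "(\<Sum>j\<in>neighbors net i. susc net (i, j) * (z i - z j)) =
     (\<Sum>e\<in>lines net. incidence net i e * susc net e * drop_along z e)"
proof -
  \<comment> \<open>Lines leaving and lines entering the bus; no line occurs in both orientations.\<close>
  let ?O = "{j. (i, j) \<in> lines net}" and ?I = "{j. (j, i) \<in> lines net}"
  have fin: "finite ?O" "finite ?I"
    using finite_subset[of ?O "snd ` lines net"] finite_subset[of ?I "fst ` lines net"]
    by (force, force)
  have out: "(\<Sum>e\<in>lines net. if i = fst e then susc net e * drop_along z e else 0) =
      (\<Sum>j\<in>?O. susc net (i, j) * (z i - z j))"
  proof -
    have "(\<Sum>e\<in>lines net. if i = fst e then susc net e * drop_along z e else 0) =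
        (\<Sum>e\<in>{e \<in> lines net. i = fst e}. susc net e * drop_along z e)"
      by (simp add: sum.inter_filter)
    also have "\<dots> = (\<Sum>j\<in>?O. susc net (i, j) * (z i - z j))"
      by (rule sum.reindex_bij_witness[of _ "\<lambda>j. (i, j)" snd]) (auto simp: drop_along_def)
    finally show ?thesis .
  qed
  have inn: "(\<Sum>e\<in>lines net. if i = snd e then susc net e * drop_along z e else 0) =
      (\<Sum>j\<in>?I. susc net (i, j) * (z j - z i))"
  proof -
    have "(\<Sum>e\<in>lines net. if i = snd e then susc net e * drop_along z e else 0) =
        (\<Sum>e\<in>{e \<in> lines net. i = snd e}. susc net e * drop_along z e)"
      by (simp add: sum.inter_filter)
    also have "\<dots> = (\<Sum>j\<in>?I. susc net (i, j) * (z j - z i))"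
      by (rule sum.reindex_bij_witness[of _ "\<lambda>j. (j, i)" fst])
        (auto simp: drop_along_def dest: susc_sym)
    finally show ?thesis .
  qed
  have "neighbors net i = ?O \<union> ?I" "?O \<inter> ?I = {}"
    using line_asym by (auto simp: neighbors_def)
  then have "(\<Sum>j\<in>neighbors net i. susc net (i, j) * (z i - z j)) =
      (\<Sum>j\<in>?O. susc net (i, j) * (z i - z j)) - (\<Sum>j\<in>?I. susc net (i, j) * (z j - z i))"
    using fin by (simp add: sum.union_disjoint sum_negf[symmetric] right_diff_distrib sum_subtractf)
  also have "\<dots> = (\<Sum>e\<in>lines net. (if i = fst e then susc net e * drop_along z e else 0)
      - (if i = snd e then susc net e * drop_along z e else 0))"
    by (simp only: out inn sum_subtractf)
  also have "\<dots> = (\<Sum>e\<in>lines net. incidence net i e * susc net e * drop_along z e)"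
    by (intro sum.cong refl) (simp add: incidence_line)
  finally show ?thesis .
qed

lemma boundary_sum:
  "(\<Sum>e\<in>boundary net k. area_incidence net k e * h e) =
     (\<Sum>e\<in>lines net. area_incidence net k e * h e :: real)"
  by (rule sum.mono_neutral_left) (auto simp: boundary_def area_incidence_def)

lemma laplacian_sum:
  "(\<Sum>j\<in>buses net. laplacian net i j * z j) =
     (\<Sum>e\<in>lines net. incidence net i e * susc net e * drop_along z e)"
proof -
  have "(\<Sum>j\<in>buses net. laplacian net i j * z j) =
      (\<Sum>e\<in>lines net. incidence net i e * susc net e * (\<Sum>j\<in>buses net. z j * incidence net j e))"
    unfolding laplacian_def sum_distrib_left sum_distrib_right
    by (subst sum.swap) (simp add: mult_ac)
  then show ?thesis by (simp add: incidence_transpose)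
qed

lemma phi_coefficient:
  "(\<Sum>j\<in>buses net. laplacian net i j * y (Lam_at j))
     - (\<Sum>k\<in>areas net. area_coupling net i k * y (Pi_at k))
     - (\<Sum>e\<in>lines net. incidence net i e * susc net e * (y (RhoP_at e) - y (RhoM_at e)))
   = (\<Sum>e\<in>lines net. incidence net i e * susc net e * line_gap net y e)"
proof -
  have "(\<Sum>k\<in>areas net. area_coupling net i k * y (Pi_at k)) =
      (\<Sum>e\<in>lines net. incidence net i e * susc net e *
         (\<Sum>k\<in>areas net. area_incidence net k e * y (Pi_at k)))"
    unfolding area_coupling_def sum_distrib_left sum_distrib_right
    by (subst sum.swap) (simp add: mult_ac)
  then show ?thesis
    by (simp add: laplacian_sum line_gap_def right_diff_distrib sum_subtractf)
qed

text \<open>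
  Exchanging the sums over buses and lines turns \<open>P\<^sup>T C\<^sup>T \<nu>\<close> into \<open>\<Sum>\<^sub>i q\<^sub>i \<nu>\<^sub>i\<close>, which belongs to the
  buses, and the term in \<open>\<phi>\<close> into a sum over lines.
\<close>
lemma lagrangian_split:
  "lagrangian net x y =
     (\<Sum>i\<in>buses net. bus_dual net i (y (Lam_at i)) (y (Nu_at i)) - outflow net x i * y (Nu_at i))
     + line_terms net x y"
proof -
  have flow: "(\<Sum>e\<in>lines net. x (P_at e) * (\<Sum>i\<in>buses net. incidence net i e * y (Nu_at i))) =
      (\<Sum>i\<in>buses net. outflow net x i * y (Nu_at i))"
    unfolding outflow_def sum_distrib_left sum_distrib_right
    by (subst sum.swap) (simp add: mult_ac)
  have "(\<Sum>i\<in>buses net. x (Phi_at i) *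
        (\<Sum>e\<in>lines net. incidence net i e * susc net e * line_gap net y e)) =
      (\<Sum>e\<in>lines net. susc net e * (\<Sum>i\<in>buses net. x (Phi_at i) * incidence net i e) *
         line_gap net y e)"
    unfolding sum_distrib_left sum_distrib_right by (subst sum.swap) (simp add: mult_ac)
  then show ?thesis
    by (simp add: lagrangian_def phi_coefficient flow line_terms_def incidence_transpose
          sum_subtractf)
qed

section \<open>Maximizing out the load frequencies\<close>

lemma cost_convex:
  assumes "i \<in> buses net"
  shows "\<exists>\<alpha>. coercive_strongly_convex (interior (load_dom net i)) (cost net i)
           (deriv (cost net i)) (deriv (deriv (cost net i))) \<alpha>"
proof -
  let ?D = "load_dom net i"
  obtain \<alpha> where \<alpha>: "\<alpha> > 0" "cost_assumption \<alpha> (cost net i) ?D"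
    using power_network assms unfolding power_network_def by blast
  have "load_lo net i < load_hi net i"
    using power_network assms unfolding power_network_def by blast
  then obtain u where u: "load_lo net i < ereal u" "ereal u < load_hi net i"
    using ereal_dense2 by blast
  have interval: "is_interval ?D"
    unfolding is_interval_1 load_dom_def
    by clarsimp (meson ereal_less_eq(3) order_trans)
  have "open {d. load_lo net i < ereal d \<and> ereal d < load_hi net i}"
    by (intro open_Collect_conj open_Collect_less continuous_intros)
  then have "u \<in> interior ?D"
    using u by (intro interiorI[of "{d. load_lo net i < ereal d \<and> ereal d < load_hi net i}"])
      (auto simp: load_dom_def)
  moreover have "frontier (interior ?D) \<subseteq> frontier ?D"
    by (auto simp: frontier_def intro: subsetD[OF closure_mono[OF interior_subset]])
  ultimately have "coercive_strongly_convex (interior ?D) (cost net i)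
           (deriv (cost net i)) (deriv (deriv (cost net i))) \<alpha>"
    using \<alpha> interval unfolding cost_assumption_def
    by unfold_locales
      (auto simp: is_interval_convex_1 convex_interior DERIV_deriv_iff_field_differentiable)
  then show ?thesis ..
qed

text \<open>
  The demand is the inverse slope of the cost, so the theory of conjugates applies with \<open>K\<close> the
  conjugate of the cost and \<open>d'\<close> the reciprocal of its second derivative at the demand.
\<close>
lemma demand_conjugate:
  assumes "i \<in> buses net"
  obtains K d' where
    "\<And>s. K s = s * demand net i s - cost net i (demand net i s)"
    "\<And>s. (K has_real_derivative demand net i s) (at s)"
    "\<And>s. (demand net i has_real_derivative d' s) (at s)"
    "\<And>s. 0 < d' s"
proof -
  obtain \<alpha> where "coercive_strongly_convex (interior (load_dom net i)) (cost net i)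
           (deriv (cost net i)) (deriv (deriv (cost net i))) \<alpha>"
    using cost_convex[OF assms] by blast
  then interpret coercive_strongly_convex "interior (load_dom net i)" "cost net i"
      "deriv (cost net i)" "deriv (deriv (cost net i))" \<alpha> .
  have eq: "demand net i = slope_inv"
    by (simp add: demand_def slope_inv_def)
  show thesis
  proof
    show "conjugate s = s * demand net i s - cost net i (demand net i s)" for s
      by (simp add: conjugate_def eq)
    show "(conjugate has_real_derivative demand net i s) (at s)" for s
      by (simp add: eq conjugate_deriv)
    show "(demand net i has_real_derivative inverse (deriv (deriv (cost net i)) (slope_inv s))) (at s)" for s
      by (simp add: eq slope_inv_deriv)
    show "0 < inverse (deriv (deriv (cost net i)) (slope_inv s))" for s
      using modulus_le[OF slope_inv_in_dom, of s] modulus_pos by simp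
  qed
qed

text \<open>
  Only the conjugate of the cost is differentiated, so the derivative of the demand does not appear.
\<close>
lemma bus_dual_deriv:
  assumes "i \<in> buses net"
    and "(l has_real_derivative l') (at t)" "(v has_real_derivative v') (at t)"
  shows "((\<lambda>s. bus_dual net i (l s) (v s)) has_real_derivative
    (pow_in net i - demand net i (l t + v t)) * (l' + v') - damp net i * v t * v') (at t)"
proof -
  obtain K d' where K: "\<And>s. K s = s * demand net i s - cost net i (demand net i s)"
    "\<And>s. (K has_real_derivative demand net i s) (at s)"
    using demand_conjugate[OF assms(1)] by metis
  have "(\<lambda>s. bus_dual net i (l s) (v s)) =
      (\<lambda>s. - K (l s + v s) - damp net i / 2 * (v s)\<^sup>2 + (l s + v s) * pow_in net i)"
    by (simp add: bus_dual_def K(1))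
  then show ?thesis
    by (auto intro!: derivative_eq_intros assms(2,3) DERIV_chain2[OF K(2)]
        simp: algebra_simps)
qed

text \<open>
  The three facts about one load bus come from a single completion of squares, which turns the scalar
  maximization into the conjugate of \<open>F(u) = c\<^sub>i\<^sup>*(u) + D\<^sub>i u\<^sup>2 / 2\<close>. The slope of \<open>F\<close> is
  \<open>d\<^sub>i(u) + D\<^sub>i u\<close>, with derivative at least \<open>D\<^sub>i\<close> since the demand is increasing, so \<open>F\<close> falls under
  the same theory as the cost.
\<close>
lemma load_optimum:
  assumes "i \<in> buses net"
  shows load_nu_strict_max: "v \<noteq> load_nu net i l q \<Longrightarrow>
      bus_dual net i l v - q * v < load_value net i l q" (is "_ \<Longrightarrow> ?max")
    and load_balance_iff: "0 = pow_in net i - (demand net i (l + v) + damp net i * v) - q \<longleftrightarrow>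
      v = load_nu net i l q" (is ?bal)
    and load_value_deriv: "\<And>l q t. (l has_real_derivative l') (at t) \<Longrightarrow>
      (q has_real_derivative q') (at t) \<Longrightarrow>
      ((\<lambda>s. load_value net i (l s) (q s)) has_real_derivative
        (pow_in net i - demand net i (l t + load_nu net i (l t) (q t))) * l'
        - load_nu net i (l t) (q t) * q') (at t)"
proof -
  let ?D = "damp net i"
  obtain K d' where K: "\<And>s. K s = s * demand net i s - cost net i (demand net i s)"
    "\<And>s. (K has_real_derivative demand net i s) (at s)"
    "\<And>s. (demand net i has_real_derivative d' s) (at s)" "\<And>s. 0 < d' s"
    using demand_conjugate[OF assms] by metis
  define F where "F u = K u + ?D / 2 * u\<^sup>2" for u
  interpret coercive_strongly_convex UNIV F "\<lambda>u. demand net i u + ?D * u"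
    "\<lambda>u. d' u + ?D" ?D
    using damp_pos[OF assms] K(4)
    by unfold_locales
      (auto simp: F_def[abs_def] intro!: derivative_eq_intros K(2,3) less_imp_le)
  have resp: "load_response net i = slope_inv"
    by (simp add: load_response_def slope_inv_def)
  \<comment> \<open>The completed square: the only dependence on \<open>v\<close> is through \<open>l + v\<close>.\<close>
  have shift: "bus_dual net i l v - q * v =
      (pow_in net i - q + ?D * l) * (l + v) - F (l + v)
      - ?D / 2 * l\<^sup>2 + l * q" for l v q
    by (simp add: bus_dual_def K(1) F_def power2_eq_square algebra_simps)
  have nu: "l + load_nu net i l q = slope_inv (pow_in net i - q + ?D * l)" for l q
    by (simp add: load_nu_def resp)
  have val: "load_value net i l q =
      conjugate (pow_in net i - q + ?D * l) - ?D / 2 * l\<^sup>2 + l * q" for l q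
    unfolding load_value_def shift nu by (simp add: conjugate_def)
  have balance: "demand net i (l + load_nu net i l q) + ?D * (l + load_nu net i l q) =
      pow_in net i - q + ?D * l" for l q
    unfolding nu by (rule slope_slope_inv)
  show ?max if "v \<noteq> load_nu net i l q"
  proof -
    have "l + v \<noteq> slope_inv (pow_in net i - q + ?D * l)" using that nu[of l q] by auto
    then show ?thesis
      unfolding shift val using conjugate_strict_max[of "l + v"] by simp
  qed
  show ?bal
  proof
    assume "0 = pow_in net i - (demand net i (l + v) + ?D * v) - q"
    then have "demand net i (l + v) + ?D * (l + v) = pow_in net i - q + ?D * l"
      by (simp add: algebra_simps)
    then have "slope_inv (pow_in net i - q + ?D * l) = l + v" by (intro slope_inv_eqI) auto
    then show "v = load_nu net i l q" using nu[of l q] by simp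
  next
    assume "v = load_nu net i l q"
    then have "demand net i (l + v) + ?D * (l + v) = pow_in net i - q + ?D * l"
      by (simp only: balance)
    then show "0 = pow_in net i - (demand net i (l + v) + ?D * v) - q"
      by (simp add: algebra_simps)
  qed
  fix l q t
  assume lq: "(l has_real_derivative l') (at t)" "(q has_real_derivative q') (at t)"
  let ?v = "load_nu net i (l t) (q t)"
  have "((\<lambda>s. load_value net i (l s) (q s)) has_real_derivative
      (l t + ?v) * (- q' + ?D * l') - ?D * l t * l' + (l' * q t + l t * q')) (at t)"
    unfolding val nu
    by (auto intro!: derivative_eq_intros lq DERIV_chain2[OF conjugate_deriv])
  moreover have "(l t + ?v) * (- q' + ?D * l') - ?D * l t * l' + (l' * q t + l t * q') =
      (pow_in net i - demand net i (l t + ?v)) * l' - ?v * q'"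
  proof -
    have d: "demand net i (l t + ?v) = pow_in net i - q t - ?D * ?v"
      using balance[of "l t" "q t"] by (simp add: algebra_simps)
    show ?thesis unfolding d by (simp add: algebra_simps)
  qed
  ultimately show "((\<lambda>s. load_value net i (l s) (q s)) has_real_derivative
        (pow_in net i - demand net i (l t + ?v)) * l' - ?v * q') (at t)"
    by simp
qed

text \<open>
  Fixing everything but the load frequencies leaves a constant plus a sum over the load buses, so the
  joint maximizer consists of the maximizers at the single buses.
\<close>
lemma reduced_argmax:
  "is_arg_max (\<lambda>\<nu>L. lagrangian net x (with_load_nu net y \<nu>L)) (\<lambda>\<nu>L. \<nu>L \<in> loads net \<rightarrow>\<^sub>E UNIV) \<nu>L
     \<longleftrightarrow> \<nu>L = restrict (bus_nu net x y) (loads net)" (is ?argmax)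
  and lagrangian_at_bus_nu:
  "lagrangian net x (with_load_nu net y (restrict (bus_nu net x y) (loads net))) =
     (\<Sum>i\<in>gens net. bus_dual net i (y (Lam_at i)) (y (Nu_at i)) - outflow net x i * y (Nu_at i))
     + (\<Sum>i\<in>loads net. load_value net i (y (Lam_at i)) (outflow net x i))
     + line_terms net x y" (is ?val)
proof -
  let ?\<theta> = "\<lambda>i v. bus_dual net i (y (Lam_at i)) v - outflow net x i * v"
  let ?K = "(\<Sum>i\<in>gens net. ?\<theta> i (y (Nu_at i))) + line_terms net x y"
  have split: "lagrangian net x (with_load_nu net y w) = ?K + (\<Sum>i\<in>loads net. ?\<theta> i (w i))" for w
  proof -
    have "line_terms net x (with_load_nu net y w) = line_terms net x y"
      by (simp add: line_terms_def line_gap_def with_load_nu_def)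
    then show ?thesis
      by (simp add: lagrangian_split sum_buses with_load_nu_def gens_not_load)
  qed
  have load: "i \<in> buses net" "bus_nu net x y i = load_nu net i (y (Lam_at i)) (outflow net x i)"
    if "i \<in> loads net" for i
    using that buses_split by (auto simp: bus_nu_def)
  show ?argmax
    unfolding split
    by (rule is_arg_max_separable)
      (auto simp: load load_value_def[symmetric] intro!: load_nu_strict_max)
  show ?val
    unfolding split by (simp add: load load_value_def)
qed

lemma nu_star_eq: "i \<in> loads net \<Longrightarrow> nu_star net x y i = bus_nu net x y i"
  by (simp add: nu_star_def reduced_argmax)

lemma red_lagrangian_eq:
  "red_lagrangian net x y =
     (\<Sum>i\<in>gens net. bus_dual net i (y (Lam_at i)) (y (Nu_at i)) - outflow net x i * y (Nu_at i))
     + (\<Sum>i\<in>loads net. load_value net i (y (Lam_at i)) (outflow net x i))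
     + line_terms net x y"
proof -
  let ?w = "restrict (bus_nu net x y) (loads net)"
  have "is_arg_max (\<lambda>\<nu>L. lagrangian net x (with_load_nu net y \<nu>L))
      (\<lambda>\<nu>L. \<nu>L \<in> loads net \<rightarrow>\<^sub>E UNIV) ?w"
    by (simp add: reduced_argmax)
  then have "red_lagrangian net x y = lagrangian net x (with_load_nu net y ?w)"
    unfolding red_lagrangian_def is_arg_max_linorder by (intro Greatest_equality) blast+
  then show ?thesis by (simp add: lagrangian_at_bus_nu)
qed

section \<open>The gradient of the reduced Lagrangian\<close>

text \<open>
  The total differential along a curve with velocities \<open>x'\<close> and \<open>y'\<close>. No derivative of the
  maximizing load frequencies occurs: at a load bus the envelope theorem removes it. A curve rather
  than a single coordinate is used because one line flow enters the outflows of two buses at once.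
\<close>
lemma red_lagrangian_deriv:
  assumes x: "\<And>c. ((\<lambda>s. x s c) has_real_derivative x' c) (at t)"
    and y: "\<And>c. ((\<lambda>s. y s c) has_real_derivative y' c) (at t)"
  shows "((\<lambda>s. red_lagrangian net (x s) (y s)) has_real_derivative
      (\<Sum>i\<in>buses net.
         (pow_in net i - demand net i (y t (Lam_at i) + bus_nu net (x t) (y t) i)) * y' (Lam_at i))
      + (\<Sum>i\<in>gens net.
         (pow_in net i - demand net i (y t (Lam_at i) + y t (Nu_at i))
           - damp net i * y t (Nu_at i) - outflow net (x t) i) * y' (Nu_at i))
      - (\<Sum>e\<in>lines net. drop_along (bus_nu net (x t) (y t)) e * x' (P_at e))
      - (\<Sum>k\<in>areas net. y' (Pi_at k) * area_pow net k)
      - (\<Sum>e\<in>lines net. y' (RhoP_at e) * flow_max net e)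
      + (\<Sum>e\<in>lines net. y' (RhoM_at e) * flow_min net e)
      - (\<Sum>e\<in>lines net. susc net e *
          (drop_along (\<lambda>i. x' (Phi_at i)) e * line_gap net (y t) e
           + drop_along (\<lambda>i. x t (Phi_at i)) e * line_gap net y' e))) (at t)"
proof -
  have flow: "((\<lambda>s. outflow net (x s) i) has_real_derivative outflow net x' i) (at t)" for i
    unfolding outflow_def by (auto intro!: derivative_eq_intros x simp: mult.commute)
  have drop: "((\<lambda>s. drop_along (\<lambda>i. x s (Phi_at i)) e) has_real_derivative
      drop_along (\<lambda>i. x' (Phi_at i)) e) (at t)" for e
    unfolding drop_along_def by (auto intro!: derivative_eq_intros x)
  have gap: "((\<lambda>s. line_gap net (y s) e) has_real_derivative line_gap net y' e) (at t)" for e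
    unfolding line_gap_def drop_along_def
    by (auto intro!: derivative_eq_intros y simp: mult.commute)
  have terms: "((\<lambda>s. line_terms net (x s) (y s)) has_real_derivative
      - (\<Sum>k\<in>areas net. y' (Pi_at k) * area_pow net k)
      - (\<Sum>e\<in>lines net. y' (RhoP_at e) * flow_max net e)
      + (\<Sum>e\<in>lines net. y' (RhoM_at e) * flow_min net e)
      - (\<Sum>e\<in>lines net. susc net e *
          (drop_along (\<lambda>i. x' (Phi_at i)) e * line_gap net (y t) e
           + drop_along (\<lambda>i. x t (Phi_at i)) e * line_gap net y' e))) (at t)"
    unfolding line_terms_def
    by (rule derivative_eq_intros y drop gap refl)+ (simp add: algebra_simps)
  let ?d = "\<lambda>i. demand net i (y t (Lam_at i) + bus_nu net (x t) (y t) i)"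
  let ?v = "bus_nu net (x t) (y t)"
  have gen: "((\<lambda>s. bus_dual net i (y s (Lam_at i)) (y s (Nu_at i)) - outflow net (x s) i * y s (Nu_at i))
      has_real_derivative (pow_in net i - ?d i) * y' (Lam_at i) - ?v i * outflow net x' i
        + (pow_in net i - ?d i - damp net i * y t (Nu_at i) - outflow net (x t) i) * y' (Nu_at i)) (at t)"
    if "i \<in> gens net" for i
  proof -
    have "i \<in> buses net" using that buses_split by blast
    then show ?thesis
      by (auto intro!: derivative_eq_intros bus_dual_deriv flow y
          simp: bus_nu_def that algebra_simps)
  qed
  have load: "((\<lambda>s. load_value net i (y s (Lam_at i)) (outflow net (x s) i))
      has_real_derivative (pow_in net i - ?d i) * y' (Lam_at i) - ?v i * outflow net x' i) (at t)"
    if "i \<in> loads net" for i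
  proof -
    have "i \<in> buses net" "i \<notin> gens net" using that buses_split by auto
    then show ?thesis
      using load_value_deriv[of i "\<lambda>s. y s (Lam_at i)" _ t "\<lambda>s. outflow net (x s) i", OF _ y flow]
      by (simp add: bus_nu_def)
  qed
  have swap: "(\<Sum>i\<in>buses net. ?v i * outflow net x' i) = (\<Sum>e\<in>lines net. drop_along ?v e * x' (P_at e))"
  proof -
    have "(\<Sum>i\<in>buses net. ?v i * outflow net x' i) =
        (\<Sum>e\<in>lines net. (\<Sum>i\<in>buses net. ?v i * incidence net i e) * x' (P_at e))"
      unfolding outflow_def sum_distrib_left sum_distrib_right
      by (subst sum.swap) (simp add: mult_ac)
    then show ?thesis by (simp add: incidence_transpose)
  qed
  show ?thesis
    unfolding red_lagrangian_eq
    by (rule DERIV_cong, (rule DERIV_add DERIV_sum gen load terms | assumption)+)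
      (simp add: swap[symmetric] sum_buses sum.distrib sum_subtractf bus_nu_def)
qed

text \<open>
  The partial derivatives are the total differential in the unit direction \<open>\<delta>\<close> of one coordinate;
  the sums then collapse to the few terms in which that coordinate occurs.
\<close>
lemma grad_red_lagrangian_dual:
  fixes x y c
  defines "\<delta> \<equiv> \<lambda>c'. if c' = c then 1 else 0"
  shows "grad (red_lagrangian net x) y c =
      (\<Sum>i\<in>buses net.
         (pow_in net i - demand net i (y (Lam_at i) + bus_nu net x y i)) * \<delta> (Lam_at i))
      + (\<Sum>i\<in>gens net.
         (pow_in net i - demand net i (y (Lam_at i) + y (Nu_at i))
           - damp net i * y (Nu_at i) - outflow net x i) * \<delta> (Nu_at i))
      - (\<Sum>k\<in>areas net. \<delta> (Pi_at k) * area_pow net k)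
      - (\<Sum>e\<in>lines net. \<delta> (RhoP_at e) * flow_max net e)
      + (\<Sum>e\<in>lines net. \<delta> (RhoM_at e) * flow_min net e)
      - (\<Sum>e\<in>lines net. susc net e * drop_along (\<lambda>i. x (Phi_at i)) e * line_gap net \<delta> e)"
proof -
  have "((\<lambda>s. (y(c := s)) c') has_real_derivative \<delta> c') (at (y c))" for c'
    by (simp add: \<delta>_def)
  from red_lagrangian_deriv[of "\<lambda>_. x" "\<lambda>_. 0" "y c" "\<lambda>s. y(c := s)", OF _ this]
  show ?thesis
    unfolding grad_def by (intro DERIV_imp_deriv) (simp add: drop_along_def mult_ac)
qed

lemma grad_red_lagrangian_primal:
  fixes x y c
  defines "\<delta> \<equiv> \<lambda>c'. if c' = c then 1 else 0"
  shows "grad (\<lambda>x'. red_lagrangian net x' y) x c =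
      - (\<Sum>e\<in>lines net. drop_along (bus_nu net x y) e * \<delta> (P_at e))
      - (\<Sum>e\<in>lines net. susc net e * drop_along (\<lambda>i. \<delta> (Phi_at i)) e * line_gap net y e)"
proof -
  have "((\<lambda>s. (x(c := s)) c') has_real_derivative \<delta> c') (at (x c))" for c'
    by (simp add: \<delta>_def)
  from red_lagrangian_deriv[of "\<lambda>s. x(c := s)" _ "x c" "\<lambda>_. y" "\<lambda>_. 0", OF this]
  show ?thesis
    unfolding grad_def
    by (intro DERIV_imp_deriv) (simp add: drop_along_def line_gap_def mult_ac)
qed

lemma grad_Lam:
  assumes "i \<in> buses net"
  shows "grad (red_lagrangian net x) y (Lam_at i) =
    pow_in net i - demand net i (y (Lam_at i) + bus_nu net x y i)
    - (\<Sum>j\<in>neighbors net i. susc net (i, j) * (x (Phi_at i) - x (Phi_at j)))"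
  unfolding grad_red_lagrangian_dual neighbor_sum[of i "\<lambda>i. x (Phi_at i)"]
  using assms by (simp add: line_gap_def drop_along_unit mult_delta_right mult_delta_left mult_ac)

lemma grad_Nu:
  assumes "i \<in> gens net"
  shows "grad (red_lagrangian net x) y (Nu_at i) =
    pow_in net i - (demand net i (y (Lam_at i) + y (Nu_at i)) + damp net i * y (Nu_at i))
    - outflow net x i"
  unfolding grad_red_lagrangian_dual
  using assms by (simp add: line_gap_def drop_along_def mult_delta_right)

lemma grad_Pi:
  assumes "k \<in> areas net"
  shows "grad (red_lagrangian net x) y (Pi_at k) =
    (\<Sum>e\<in>boundary net k. area_incidence net k e * (susc net e * drop_along (\<lambda>i. x (Phi_at i)) e))
    - area_pow net k"
  unfolding grad_red_lagrangian_dual boundary_sum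
  using assms
  by (simp add: line_gap_def drop_along_def mult_delta_right mult_delta_left sum_negf mult_ac)

lemma grad_RhoP:
  assumes "e \<in> lines net"
  shows "grad (red_lagrangian net x) y (RhoP_at e) =
    susc net e * drop_along (\<lambda>i. x (Phi_at i)) e - flow_max net e"
  unfolding grad_red_lagrangian_dual
  using assms
  by (simp add: line_gap_def drop_along_def mult_delta_right mult_delta_left sum_negf)

lemma grad_RhoM:
  assumes "e \<in> lines net"
  shows "grad (red_lagrangian net x) y (RhoM_at e) =
    flow_min net e - susc net e * drop_along (\<lambda>i. x (Phi_at i)) e"
  unfolding grad_red_lagrangian_dual
  using assms
  by (simp add: line_gap_def drop_along_def mult_delta_right mult_delta_left sum_negf)

lemma grad_P:
  assumes "e \<in> lines net"
  shows "grad (\<lambda>x'. red_lagrangian net x' y) x (P_at e) = - drop_along (bus_nu net x y) e"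
  unfolding grad_red_lagrangian_primal
  using assms by (simp add: drop_along_def mult_delta_right)

lemma grad_Phi:
  "grad (\<lambda>x'. red_lagrangian net x' y) x (Phi_at i) =
    - ((\<Sum>j\<in>neighbors net i. susc net (i, j) * (y (Lam_at i) - y (Lam_at j)))
       - (\<Sum>k\<in>areas net. \<Sum>e\<in>boundary net k.
            incidence net i e * susc net e * area_incidence net k e * y (Pi_at k))
       - (\<Sum>e\<in>lines net. incidence net i e * susc net e * (y (RhoP_at e) - y (RhoM_at e))))"
proof -
  have "(\<Sum>e\<in>boundary net k. incidence net i e * susc net e * area_incidence net k e * y (Pi_at k))
      = area_coupling net i k * y (Pi_at k)" for k
    using boundary_sum[of k "\<lambda>e. incidence net i e * susc net e * y (Pi_at k)"]
    by (simp add: area_coupling_def sum_distrib_left sum_distrib_right mult_ac)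
  moreover have "grad (\<lambda>x'. red_lagrangian net x' y) x (Phi_at i) =
      - (\<Sum>e\<in>lines net. incidence net i e * susc net e * line_gap net y e)"
    unfolding grad_red_lagrangian_primal by (simp add: drop_along_unit mult_ac)
  ultimately show ?thesis
    by (simp add: phi_coefficient[symmetric] laplacian_sum neighbor_sum[of i "\<lambda>i. y (Lam_at i)"])
qed

end

section \<open>Equivalence of the two systems\<close>

theorem theorem5:
  fixes net :: "('n, 'k) network"
    and X :: "'n primal_coord \<Rightarrow> real"
    and Y :: "('n, 'k) dual_coord \<Rightarrow> real"
    and T :: "real set"
    and sol :: sol_concept
    and \<phi> l \<nu> \<omega> d :: "real \<Rightarrow> 'n \<Rightarrow> real"
    and P rp rm :: "real \<Rightarrow> 'n \<times> 'n \<Rightarrow> real"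
    and p :: "real \<Rightarrow> 'k \<Rightarrow> real"
    and x :: "real \<Rightarrow> 'n primal_coord \<Rightarrow> real"
    and y :: "real \<Rightarrow> ('n, 'k) dual_coord \<Rightarrow> real"
  assumes "power_network net"
    and "\<forall>c \<in> primal_idx net. X c > 0"
    and "\<forall>c \<in> dual_idx net. Y c > 0"
    and "\<forall>i \<in> gens net. Y (Nu_at i) = inverse (inertia net i)"
    and "\<forall>e \<in> lines net. X (P_at e) = susc net e"
    and "is_interval T"
    and "sol \<in> {classical_sol, caratheodory_sol}"
    and "\<forall>t. x t = case_primal_coord (\<phi> t) (P t)"
    and "\<forall>t. y t = case_dual_coord (l t) (\<nu> t) (p t) (rp t) (rm t)"
    and "\<forall>t \<in> T. \<forall>i \<in> gens net. \<nu> t i = \<omega> t i"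
  shows "network_dynamics net X Y sol T \<omega> d \<phi> P l p rp rm \<longleftrightarrow>
    primal_dual_law net X Y sol T x y \<and>
    (\<forall>t \<in> T. \<forall>i \<in> loads net. nu_star net (x t) (y t) i = \<omega> t i) \<and>
    (\<forall>t \<in> T. \<forall>i \<in> buses net. d t i = demand net i (l t i + \<omega> t i))"
    (is "_ \<longleftrightarrow> _ \<and> ?load_nu \<and> ?demand")
proof -
  interpret power_system net using assms(1) by unfold_locales
  note cong = sol_cong[OF assms(6,7)]
  let ?fy = "\<lambda>c t. Y c * rho_proj (y t) (grad (red_lagrangian net (x t)) (y t)) c"
  let ?fx = "\<lambda>c t. - X c * grad (\<lambda>x'. red_lagrangian net x' (y t)) (x t) c"
  let ?load_balance = "\<forall>i \<in> loads net. \<forall>t \<in> T.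
      0 = pow_in net i - (d t i + damp net i * \<omega> t i)
            - (\<Sum>e\<in>lines net. incidence net i e * P t e)"
  have coord: "x t (Phi_at i) = \<phi> t i" "x t (P_at e) = P t e"
    "y t (Lam_at i) = l t i" "y t (Nu_at i) = \<nu> t i" "y t (Pi_at k) = p t k"
    "y t (RhoP_at e) = rp t e" "y t (RhoM_at e) = rm t e" for t i k e
    using assms(8,9) by simp_all
  have flow: "outflow net (x t) i = (\<Sum>e\<in>lines net. incidence net i e * P t e)" for t i
    by (simp add: outflow_def coord)
  \<comment> \<open>Once \<open>d\<close> is the demand, both systems impose the same algebraic constraint at the loads.\<close>
  have load_iff: "?load_balance \<longleftrightarrow> ?load_nu" if ?demand
  proof -
    have "0 = pow_in net i - (d t i + damp net i * \<omega> t i)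
            - (\<Sum>e\<in>lines net. incidence net i e * P t e) \<longleftrightarrow> nu_star net (x t) (y t) i = \<omega> t i"
      if "t \<in> T" "i \<in> loads net" for t i
    proof -
      have "i \<in> buses net" "i \<notin> gens net" using that buses_split by auto
      then show ?thesis
        using load_balance_iff[of i "l t i" "\<omega> t i" "outflow net (x t) i"] \<open>?demand\<close> that
        by (auto simp: nu_star_eq bus_nu_def coord flow)
    qed
    then show ?thesis by blast
  qed
  show ?thesis
  proof (cases "?load_nu \<and> ?demand")
    case False
    then show ?thesis using load_iff unfolding network_dynamics_def by blast
  next
    case True
    then have ?load_nu and dem: "\<And>t i. t \<in> T \<Longrightarrow> i \<in> buses net \<Longrightarrow> d t i = demand net i (l t i + \<omega> t i)"
      by blast+
    \<comment> \<open>Under the constraint, the frequency that the gradient formulas evaluate is \<open>\<omega>\<close> at every bus: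
      by hypothesis at generators and by maximality at loads.\<close>
    have nu: "bus_nu net (x t) (y t) i = \<omega> t i" if "t \<in> T" "i \<in> buses net" for t i
    proof (cases "i \<in> gens net")
      case True
      then show ?thesis using assms(10) that by (simp add: bus_nu_def coord)
    next
      case False
      then have "i \<in> loads net" using that buses_split by blast
      then show ?thesis using \<open>?load_nu\<close> that by (simp add: nu_star_eq)
    qed
    \<comment> \<open>Dividing the swing equation by the inertia produces the prescribed gain \<open>\<zeta>\<^sub>i\<^sup>\<nu> = M\<^sub>i\<^sup>-\<^sup>1\<close>.\<close>
    have gen: "(\<forall>i \<in> gens net. sol T (\<lambda>t. inertia net i * \<omega> t i)
        (\<lambda>t. pow_in net i - (d t i + damp net i * \<omega> t i)
               - (\<Sum>e\<in>lines net. incidence net i e * P t e)))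
        \<longleftrightarrow> (\<forall>i \<in> gens net. sol T (\<lambda>t. y t (Nu_at i)) (?fy (Nu_at i)))"
    proof (intro ball_cong refl)
      fix i assume i: "i \<in> gens net"
      then have "i \<in> buses net" "inertia net i \<noteq> 0" using buses_split inertia_pos by force+
      then show "sol T (\<lambda>t. inertia net i * \<omega> t i)
        (\<lambda>t. pow_in net i - (d t i + damp net i * \<omega> t i)
               - (\<Sum>e\<in>lines net. incidence net i e * P t e))
        \<longleftrightarrow> sol T (\<lambda>t. y t (Nu_at i)) (?fy (Nu_at i))"
        unfolding sol_scale[OF assms(7) \<open>inertia net i \<noteq> 0\<close>]
        using i assms(4,10) by (intro cong) (simp_all add: rho_proj_def grad_Nu coord flow dem)
    qed
    have flows: "(\<forall>(i, j) \<in> lines net. sol T (\<lambda>t. P t (i, j))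
        (\<lambda>t. susc net (i, j) * (\<omega> t i - \<omega> t j)))
        \<longleftrightarrow> (\<forall>e \<in> lines net. sol T (\<lambda>t. x t (P_at e)) (?fx (P_at e)))"
      unfolding case_prod_beta' prod.collapse using assms(5)
      by (intro ball_cong refl cong) (simp_all add: coord grad_P drop_along_def nu line_ends algebra_simps)
    have lam: "(\<forall>i \<in> buses net. sol T (\<lambda>t. l t i)
        (\<lambda>t. Y (Lam_at i) * (pow_in net i - d t i
               - (\<Sum>j\<in>neighbors net i. susc net (i, j) * (\<phi> t i - \<phi> t j)))))
        \<longleftrightarrow> (\<forall>i \<in> buses net. sol T (\<lambda>t. y t (Lam_at i)) (?fy (Lam_at i)))"
      by (intro ball_cong refl cong) (simp_all add: coord rho_proj_def grad_Lam nu dem)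
    have area: "(\<forall>k \<in> areas net. sol T (\<lambda>t. p t k)
        (\<lambda>t. Y (Pi_at k) *
          ((\<Sum>(i, j)\<in>boundary net k.
              area_incidence net k (i, j) * susc net (i, j) * (\<phi> t i - \<phi> t j))
           - area_pow net k)))
        \<longleftrightarrow> (\<forall>k \<in> areas net. sol T (\<lambda>t. y t (Pi_at k)) (?fy (Pi_at k)))"
      by (intro ball_cong refl cong)
        (simp_all add: coord rho_proj_def grad_Pi drop_along_def case_prod_beta' mult.assoc)
    have upper: "(\<forall>(i, j) \<in> lines net. sol T (\<lambda>t. rp t (i, j))
        (\<lambda>t. Y (RhoP_at (i, j)) * pos_proj (rp t (i, j))
               (susc net (i, j) * (\<phi> t i - \<phi> t j) - flow_max net (i, j))))
        \<longleftrightarrow> (\<forall>e \<in> lines net. sol T (\<lambda>t. y t (RhoP_at e)) (?fy (RhoP_at e)))"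
      unfolding case_prod_beta' prod.collapse
      by (intro ball_cong refl cong) (simp_all add: coord rho_proj_def grad_RhoP drop_along_def)
    have lower: "(\<forall>(i, j) \<in> lines net. sol T (\<lambda>t. rm t (i, j))
        (\<lambda>t. Y (RhoM_at (i, j)) * pos_proj (rm t (i, j))
               (flow_min net (i, j) - susc net (i, j) * (\<phi> t i - \<phi> t j))))
        \<longleftrightarrow> (\<forall>e \<in> lines net. sol T (\<lambda>t. y t (RhoM_at e)) (?fy (RhoM_at e)))"
      unfolding case_prod_beta' prod.collapse
      by (intro ball_cong refl cong) (simp_all add: coord rho_proj_def grad_RhoM drop_along_def)
    have phase: "(\<forall>i \<in> buses net. sol T (\<lambda>t. \<phi> t i)
        (\<lambda>t. X (Phi_at i) *
          ((\<Sum>j\<in>neighbors net i. susc net (i, j) * (l t i - l t j))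
           - (\<Sum>k\<in>areas net. \<Sum>e\<in>boundary net k.
                incidence net i e * susc net e * area_incidence net k e * p t k)
           - (\<Sum>e\<in>lines net. incidence net i e * susc net e * (rp t e - rm t e)))))
        \<longleftrightarrow> (\<forall>i \<in> buses net. sol T (\<lambda>t. x t (Phi_at i)) (?fx (Phi_at i)))"
      by (intro ball_cong refl cong) (simp_all add: coord grad_Phi algebra_simps)
    have balance: ?load_balance and demands: "\<forall>i \<in> buses net. \<forall>t \<in> T. d t i = demand net i (l t i + \<omega> t i)"
      using load_iff True by blast+
    have ball_image: "(\<forall>c\<in>h ` S. Q c) \<longleftrightarrow> (\<forall>i\<in>S. Q (h i))" for h S Q
      by blast
    show ?thesis
      unfolding network_dynamics_def gen flows lam area upper lower phase
        primal_dual_law_def dual_idx_def primal_idx_def ball_Un ball_image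
      using balance demands True by (intro iffI conjI) (elim conjE, assumption)+
  qed
qed

end
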